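(* Let $(X,\mathscr{A},\mu)$ be a probability measure space. Then $\mathcal{M}_\mu$ is not a compact space.
   Context: $\mathcal{M}$ is the ring of real-valued measurable functions on $(X,\mathscr{A},\mu)$, where two functions that are equal $\mu$-almost everywhere are identified. A sequence $\{f_n\}$ in $\mathcal{M}$ converges in measure to $f\in\mathcal{M}$ if for each $c>0$, $\lim_{n\to\infty}\mu(\{x\in X:|f_n(x)-f(x)|>c\})=0$. For $A\subseteq\mathcal{M}$, $\overline{A}$ is the set of all $f\in\mathcal{M}$ for which there is a sequence in $A$ converging to $f$ in measure. $\mathcal{M}_\mu$ denotes $\mathcal{M}$ with the topology of convergence in measure, i.e. the topology $\{\mathcal{M}\setminus A: A\subseteq\mathcal{M},\ A=\overline{A}\}$. *)

theory Defs
  imports "HOL-Probability.Probability"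
begin

definition ae_eq_rel :: "'a measure \<Rightarrow> (('a \<Rightarrow> real) \<times> ('a \<Rightarrow> real)) set" where
  "ae_eq_rel M = {(f, g). f \<in> borel_measurable M \<and> g \<in> borel_measurable M \<and> (AE x in M. f x = g x)}"

definition meas_funs :: "'a measure \<Rightarrow> ('a \<Rightarrow> real) set set" where
  "meas_funs M = borel_measurable M // ae_eq_rel M"

(* emeasure rather than measure, because measure assigns 0 to sets of infinite measure. *)
definition fun_converges_in_measure :: "'a measure \<Rightarrow> (nat \<Rightarrow> 'a \<Rightarrow> real) \<Rightarrow> ('a \<Rightarrow> real) \<Rightarrow> bool" where
  "fun_converges_in_measure M u g \<longleftrightarrow>
     (\<forall>c>0. (\<lambda>n. emeasure M {x \<in> space M. \<bar>u n x - g x\<bar> > c}) \<longlonglongrightarrow> 0)"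

(* The choice of representatives is immaterial: see converges_in_measure_representatives below. *)
definition converges_in_measure :: "'a measure \<Rightarrow> (nat \<Rightarrow> ('a \<Rightarrow> real) set) \<Rightarrow> ('a \<Rightarrow> real) set \<Rightarrow> bool" where
  "converges_in_measure M F G \<longleftrightarrow>
     (\<exists>u g. (\<forall>n. u n \<in> F n) \<and> g \<in> G \<and> fun_converges_in_measure M u g)"

definition measure_closure :: "'a measure \<Rightarrow> ('a \<Rightarrow> real) set set \<Rightarrow> ('a \<Rightarrow> real) set set" where
  "measure_closure M A =
     {G \<in> meas_funs M. \<exists>F. (\<forall>n. F n \<in> A) \<and> converges_in_measure M F G}"

(* That these sets form a topology is istopology_measure_topology; its carrier is meas_funs M. *)
definition measure_topology :: "'a measure \<Rightarrow> ('a \<Rightarrow> real) set topology" where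
  "measure_topology M =
     topology (\<lambda>U. \<exists>A. A \<subseteq> meas_funs M \<and> A = measure_closure M A \<and> U = meas_funs M - A)"

lemma equiv_ae_eq_rel: "equiv (borel_measurable M) (ae_eq_rel M)"
proof (rule equivI)
  show "ae_eq_rel M \<subseteq> borel_measurable M \<times> borel_measurable M"
    by (auto simp: ae_eq_rel_def)
  show "refl_on (borel_measurable M) (ae_eq_rel M)"
    by (auto simp: refl_on_def ae_eq_rel_def)
  show "sym (ae_eq_rel M)"
    by (auto simp: sym_def ae_eq_rel_def elim: AE_mp)
  show "trans (ae_eq_rel M)"
    unfolding trans_def ae_eq_rel_def by (auto elim: AE_mp)
qed

lemma meas_funs_sameD:
  assumes "G \<in> meas_funs M" "f \<in> G" "g \<in> G"
  shows "f \<in> borel_measurable M" "g \<in> borel_measurable M" "AE x in M. f x = g x"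
proof -
  have "(f, g) \<in> ae_eq_rel M"
    using assms quotient_eq_iff[OF equiv_ae_eq_rel, of G M G f g] by (simp add: meas_funs_def)
  then show "f \<in> borel_measurable M" "g \<in> borel_measurable M" "AE x in M. f x = g x"
    by (auto simp: ae_eq_rel_def)
qed

lemma converges_in_measure_representatives:
  assumes F: "\<And>n. F n \<in> meas_funs M" and G: "G \<in> meas_funs M"
    and u: "\<And>n. u n \<in> F n" and g: "g \<in> G"
  shows "converges_in_measure M F G \<longleftrightarrow> fun_converges_in_measure M u g"
proof
  assume "fun_converges_in_measure M u g"
  then show "converges_in_measure M F G"
    using u g by (auto simp: converges_in_measure_def)
next
  assume "converges_in_measure M F G"
  then obtain v h where v: "\<And>n. v n \<in> F n" and h: "h \<in> G" and conv: "fun_converges_in_measure M v h"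
    by (auto simp: converges_in_measure_def)
  have "emeasure M {x \<in> space M. \<bar>u n x - g x\<bar> > c} = emeasure M {x \<in> space M. \<bar>v n x - h x\<bar> > c}"
    for n c
  proof (rule emeasure_eq_AE)
    note [measurable] = meas_funs_sameD(1,2)[OF F u v] meas_funs_sameD(1,2)[OF G g h]
    show "{x \<in> space M. \<bar>u n x - g x\<bar> > c} \<in> sets M" "{x \<in> space M. \<bar>v n x - h x\<bar> > c} \<in> sets M"
      by measurable
    show "AE x in M. x \<in> {x \<in> space M. \<bar>u n x - g x\<bar> > c} \<longleftrightarrow> x \<in> {x \<in> space M. \<bar>v n x - h x\<bar> > c}"
      using meas_funs_sameD(3)[OF F u v, of n] meas_funs_sameD(3)[OF G g h] by eventually_elim auto
  qed
  then show "fun_converges_in_measure M u g"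
    using conv by (simp add: fun_converges_in_measure_def)
qed

lemma measure_closure_superset:
  assumes "A \<subseteq> meas_funs M"
  shows "A \<subseteq> measure_closure M A"
proof
  fix G assume G: "G \<in> A"
  with assms have GM: "G \<in> meas_funs M" by auto
  then obtain g where g: "g \<in> G"
    using in_quotient_imp_non_empty[OF equiv_ae_eq_rel] by (fastforce simp: meas_funs_def)
  have "fun_converges_in_measure M (\<lambda>_. g) g"
    by (auto simp: fun_converges_in_measure_def)
  then have "converges_in_measure M (\<lambda>_. G) G"
    using g by (auto simp: converges_in_measure_def)
  then show "G \<in> measure_closure M A"
    using G GM by (auto simp: measure_closure_def)
qed

lemma measure_closure_mono: "A \<subseteq> B \<Longrightarrow> measure_closure M A \<subseteq> measure_closure M B"
  by (fastforce simp: measure_closure_def)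

lemma converges_in_measure_subseq:
  assumes "converges_in_measure M F G" "strict_mono r"
  shows "converges_in_measure M (F \<circ> r) G"
proof -
  obtain u g where u: "\<And>n. u n \<in> F n" and g: "g \<in> G" and conv: "fun_converges_in_measure M u g"
    using assms(1) by (auto simp: converges_in_measure_def)
  have "fun_converges_in_measure M (u \<circ> r) g"
    unfolding fun_converges_in_measure_def
  proof (intro allI impI)
    fix c :: real assume "c > 0"
    then have "(\<lambda>n. emeasure M {x \<in> space M. \<bar>u n x - g x\<bar> > c}) \<longlonglongrightarrow> 0"
      using conv by (auto simp: fun_converges_in_measure_def)
    from LIMSEQ_subseq_LIMSEQ[OF this assms(2)]
    show "(\<lambda>n. emeasure M {x \<in> space M. \<bar>(u \<circ> r) n x - g x\<bar> > c}) \<longlonglongrightarrow> 0"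
      by (simp add: o_def)
  qed
  then show ?thesis
    unfolding converges_in_measure_def using u g by (intro exI[of _ "u \<circ> r"] exI[of _ g]) auto
qed

lemma measure_closure_Un:
  "measure_closure M (A \<union> B) \<subseteq> measure_closure M A \<union> measure_closure M B"
proof
  fix G assume "G \<in> measure_closure M (A \<union> B)"
  then obtain F where G: "G \<in> meas_funs M" and F: "\<And>n. F n \<in> A \<union> B"
    and conv: "converges_in_measure M F G"
    by (auto simp: measure_closure_def)
  have *: "G \<in> measure_closure M C" if inf: "infinite {n. F n \<in> C}" for C
  proof -
    obtain r :: "nat \<Rightarrow> nat" where r: "strict_mono r" "\<And>n. r n \<in> {n. F n \<in> C}"
      using infinite_enumerate[OF inf] by auto
    show ?thesis
      unfolding measure_closure_def
      using G r converges_in_measure_subseq[OF conv r(1)] by (auto intro!: exI[of _ "F \<circ> r"])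
  qed
  have "{n. F n \<in> A} \<union> {n. F n \<in> B} = UNIV" using F by auto
  then have "infinite {n. F n \<in> A} \<or> infinite {n. F n \<in> B}"
    by (metis finite_Un infinite_UNIV_nat)
  with * show "G \<in> measure_closure M A \<union> measure_closure M B" by auto
qed

lemma istopology_measure_topology:
  "istopology (\<lambda>U. \<exists>A. A \<subseteq> meas_funs M \<and> A = measure_closure M A \<and> U = meas_funs M - A)"
    (is "istopology ?open")
proof -
  have iff: "?open U \<longleftrightarrow> U \<subseteq> meas_funs M \<and> measure_closure M (meas_funs M - U) \<subseteq> meas_funs M - U"
    for U
  proof
    assume "?open U"
    then obtain A where "A \<subseteq> meas_funs M" "A = measure_closure M A" "U = meas_funs M - A" by blast
    moreover from this have "meas_funs M - U = A" by blast
    ultimately show "U \<subseteq> meas_funs M \<and> measure_closure M (meas_funs M - U) \<subseteq> meas_funs M - U"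
      by auto
  next
    assume "U \<subseteq> meas_funs M \<and> measure_closure M (meas_funs M - U) \<subseteq> meas_funs M - U"
    then show "?open U"
      using measure_closure_superset[of "meas_funs M - U" M]
      by (intro exI[of _ "meas_funs M - U"]) auto
  qed
  show ?thesis
    unfolding istopology_def iff
  proof (intro conjI allI impI)
    fix S T
    assume S: "S \<subseteq> meas_funs M \<and> measure_closure M (meas_funs M - S) \<subseteq> meas_funs M - S"
      and T: "T \<subseteq> meas_funs M \<and> measure_closure M (meas_funs M - T) \<subseteq> meas_funs M - T"
    then show "S \<inter> T \<subseteq> meas_funs M" by auto
    show "measure_closure M (meas_funs M - S \<inter> T) \<subseteq> meas_funs M - S \<inter> T"
      using measure_closure_Un[of M "meas_funs M - S" "meas_funs M - T"] S T
      unfolding Diff_Int by auto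
  next
    fix K
    assume K: "\<forall>U\<in>K. U \<subseteq> meas_funs M \<and> measure_closure M (meas_funs M - U) \<subseteq> meas_funs M - U"
    then show "\<Union>K \<subseteq> meas_funs M" by auto
    have "measure_closure M (meas_funs M - \<Union>K) \<subseteq> meas_funs M"
      by (auto simp: measure_closure_def)
    moreover have "measure_closure M (meas_funs M - \<Union>K) \<subseteq> meas_funs M - U" if "U \<in> K" for U
      using K that measure_closure_mono[of "meas_funs M - \<Union>K" "meas_funs M - U" M] by auto
    ultimately show "measure_closure M (meas_funs M - \<Union>K) \<subseteq> meas_funs M - \<Union>K" by blast
  qed
qed

lemma openin_measure_topology:
  "openin (measure_topology M) U \<longleftrightarrow>
     (\<exists>A. A \<subseteq> meas_funs M \<and> A = measure_closure M A \<and> U = meas_funs M - A)"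
  unfolding measure_topology_def topology_inverse'[OF istopology_measure_topology] ..

lemma topspace_measure_topology: "topspace (measure_topology M) = meas_funs M"
proof
  show "topspace (measure_topology M) \<subseteq> meas_funs M"
    unfolding topspace_def openin_measure_topology by auto
  have "openin (measure_topology M) (meas_funs M)"
    unfolding openin_measure_topology by (intro exI[of _ "{}"]) (auto simp: measure_closure_def)
  then show "meas_funs M \<subseteq> topspace (measure_topology M)"
    by (rule openin_subset)
qed

end

theory Submission
  imports Defs
begin

text \<open>
  A sequence of constants that converges in measure on a probability space is a Cauchy sequence of
  reals, since two events of probability greater than 1/2 meet; its limit in measure is the limit of the reals.
  Hence the constants embed the closed subsets of the real line as closed subsets of the space, and
  the images of the half-lines \<open>{n..}\<close> form a decreasing sequence of nonempty closed sets with empty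
  intersection.
\<close>

definition const_class :: "'a measure \<Rightarrow> real \<Rightarrow> ('a \<Rightarrow> real) set" where
  "const_class M c = ae_eq_rel M `` {\<lambda>_. c}"

lemma mem_const_class_iff: "g \<in> const_class M c \<longleftrightarrow> g \<in> borel_measurable M \<and> (AE x in M. g x = c)"
  by (auto simp: const_class_def ae_eq_rel_def eq_commute)

lemma const_class_in_meas_funs: "const_class M c \<in> meas_funs M"
  unfolding const_class_def meas_funs_def by (intro quotientI) simp

text \<open>Equivalence classes are equal or disjoint, and \<open>g\<close> lies in both of
  these.\<close>

lemma meas_funs_eq_const_class:
  assumes "G \<in> meas_funs M" "g \<in> G" "AE x in M. g x = c"
  shows "G = const_class M c"
proof -
  have "g \<in> const_class M c"
    using assms meas_funs_sameD(1)[OF assms(1,2,2)] by (simp add: mem_const_class_iff)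
  then show ?thesis
    using quotient_disj[OF equiv_ae_eq_rel, of G M "const_class M c"] assms(1,2)
      const_class_in_meas_funs[of M c] by (auto simp: meas_funs_def)
qed

context prob_space
begin

text \<open>A probability space is not null, so a statement independent of \<open>x\<close> that
  holds almost everywhere is true. On a null space all constants would be identified.\<close>

lemma inj_const_class: "inj (const_class M)"
proof
  fix c d assume "const_class M c = const_class M d"
  moreover have "(\<lambda>_. c) \<in> const_class M c" by (simp add: mem_const_class_iff)
  ultimately have "AE x in M. c = d" by (simp add: mem_const_class_iff)
  then show "c = d" by simp
qed

lemma consts_converging_in_measureD:
  assumes conv: "fun_converges_in_measure M (\<lambda>n _. a n) g" and [measurable]: "g \<in> borel_measurable M"
  shows "Cauchy a" "a \<longlonglongrightarrow> l \<Longrightarrow> AE x in M. g x = l"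
proof -
  have small: "\<forall>\<^sub>F n in sequentially. emeasure M {x \<in> space M. \<bar>a n - g x\<bar> > c} < e"
    if "c > 0" "e > 0" for c e
    using conv that unfolding fun_converges_in_measure_def by (auto dest: order_tendstoD(2))
  show "Cauchy a"
  proof (rule metric_CauchyI)
    fix e :: real assume "e > 0"
    \<comment> \<open>Two events of probability below 1/2 cannot cover the space. A point
      \<open>x\<close> outside both has \<open>g x\<close> within \<open>e/3\<close> of
      \<open>a m\<close> and of \<open>a n\<close>, so these differ by at most
      \<open>2*e/3 < e\<close>.\<close>
    then have "\<forall>\<^sub>F n in sequentially. emeasure M {x \<in> space M. \<bar>a n - g x\<bar> > e/3} < ennreal (1/2)"
      by (intro small) (linarith, subst ennreal_less_zero_iff, simp)
    then obtain N where N: "\<And>n. n \<ge> N \<Longrightarrow> emeasure M {x \<in> space M. \<bar>a n - g x\<bar> > e/3} < ennreal (1/2)"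
      unfolding eventually_sequentially by blast
    show "\<exists>N. \<forall>m\<ge>N. \<forall>n\<ge>N. dist (a m) (a n) < e"
    proof (intro exI allI impI)
      fix m n assume mn: "m \<ge> N" "n \<ge> N"
      let ?B = "\<lambda>n. {x \<in> space M. \<bar>a n - g x\<bar> > e/3}"
      have half: "prob (?B k) < 1/2" if "k \<ge> N" for k
        using N[OF that] unfolding emeasure_eq_measure by (subst (asm) ennreal_less_iff) simp_all
      have "prob (?B m \<union> ?B n) \<le> prob (?B m) + prob (?B n)"
        by (intro measure_Un_le) measurable
      with half[OF mn(1)] half[OF mn(2)] have "prob (?B m \<union> ?B n) < prob (space M)"
        by (simp add: prob_space)
      then have "?B m \<union> ?B n \<noteq> space M" by (metis less_irrefl)
      then obtain x where "x \<in> space M" "x \<notin> ?B m" "x \<notin> ?B n" by blast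
      then have "\<bar>a m - g x\<bar> \<le> e/3" "\<bar>a n - g x\<bar> \<le> e/3" by simp_all
      then show "dist (a m) (a n) < e" 
        using \<open>e > 0\<close> unfolding dist_real_def by linarith
    qed
  qed
  assume lim: "a \<longlonglongrightarrow> l"
  have "AE x in M. \<bar>g x - l\<bar> \<le> c" if "c > 0" for c
  proof -
    \<comment> \<open>Once \<open>a n\<close> is within \<open>c/2\<close> of \<open>l\<close>, a
      deviation of \<open>g x\<close> from \<open>l\<close> above \<open>c\<close> forces one from
      \<open>a n\<close> above \<open>c/2\<close>. The bad set does not depend on \<open>n\<close>,
      so its measure is below every positive \<open>e\<close>, hence zero.\<close>
    have le: "emeasure M {x \<in> space M. \<bar>g x - l\<bar> > c} \<le> e" if "e > 0" for e
    proof -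
      have "\<forall>\<^sub>F n in sequentially. dist (a n) l < c/2"
        using lim \<open>c > 0\<close> by (intro tendstoD) simp_all
      moreover have "\<forall>\<^sub>F n in sequentially. emeasure M {x \<in> space M. \<bar>a n - g x\<bar> > c/2} < e"
        using small[OF half_gt_zero[OF \<open>c > 0\<close>] \<open>e > 0\<close>] .
      ultimately have "\<forall>\<^sub>F n in sequentially.
          dist (a n) l < c/2 \<and> emeasure M {x \<in> space M. \<bar>a n - g x\<bar> > c/2} < e"
        by (rule eventually_conj)
      from eventually_happens'[OF sequentially_bot this] obtain n where n: "dist (a n) l < c/2"
          "emeasure M {x \<in> space M. \<bar>a n - g x\<bar> > c/2} < e" by blast
      have "{x \<in> space M. \<bar>g x - l\<bar> > c} \<subseteq> {x \<in> space M. \<bar>a n - g x\<bar> > c/2}"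
        using n(1) unfolding dist_real_def by (intro Collect_mono impI conjI) (simp, linarith)
      then have "emeasure M {x \<in> space M. \<bar>g x - l\<bar> > c} \<le> emeasure M {x \<in> space M. \<bar>a n - g x\<bar> > c/2}"
        by (intro emeasure_mono) simp_all
      with n(2) show ?thesis by simp
    qed
    have "emeasure M {x \<in> space M. \<bar>g x - l\<bar> > c} = 0"
      using le dense_ge[of 0 "emeasure M {x \<in> space M. \<bar>g x - l\<bar> > c}"] by simp
    then show ?thesis by (subst AE_iff_measurable[OF _ refl]) (auto simp: not_le)
  qed
  \<comment> \<open>Only countably many null sets may be united, so \<open>c\<close> is restricted
    to the values \<open>inverse (real (Suc k))\<close>, which still tend to 0.\<close>
  then have "AE x in M. \<forall>k. \<bar>g x - l\<bar> \<le> inverse (real (Suc k))"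
    by (simp add: AE_all_countable)
  then show "AE x in M. g x = l"
  proof eventually_elim
    case (elim x)
    show ?case
    proof (rule ccontr)
      assume "g x \<noteq> l"
      then obtain k where "inverse (real (Suc k)) < \<bar>g x - l\<bar>"
        using reals_Archimedean[of "\<bar>g x - l\<bar>"] by auto
      with elim[rule_format, of k] show False by linarith
    qed
  qed
qed

text \<open>Completeness of the reals yields a limit \<open>l\<close> of the constants, closedness
  of \<open>S\<close> gives \<open>l \<in> S\<close>, and the limit class must be that of
  \<open>l\<close>.\<close>

lemma closedin_const_class_image:
  assumes "closed S"
  shows "closedin (measure_topology M) (const_class M ` S)"
proof -
  let ?A = "const_class M ` S"
  have sub: "?A \<subseteq> meas_funs M" by (auto simp: const_class_in_meas_funs)
  have "measure_closure M ?A \<subseteq> ?A"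
  proof
    fix G assume "G \<in> measure_closure M ?A"
    then obtain F where G: "G \<in> meas_funs M" and F: "\<And>n. F n \<in> ?A"
      and conv: "converges_in_measure M F G" by (auto simp: measure_closure_def)
    from F obtain a where a: "\<And>n. a n \<in> S" "\<And>n. F n = const_class M (a n)"
      unfolding image_iff by metis
    obtain g where g: "g \<in> G"
      using G in_quotient_imp_non_empty[OF equiv_ae_eq_rel] by (fastforce simp: meas_funs_def)
    have g_meas: "g \<in> borel_measurable M" using meas_funs_sameD(1)[OF G g g] .
    \<comment> \<open>Convergence of classes does not depend on representatives, so the constant
      functions themselves may represent the classes \<open>F n\<close>.\<close>
    have conv': "fun_converges_in_measure M (\<lambda>n _. a n) g"
      using conv F sub G g a(2)
      by (subst converges_in_measure_representatives[symmetric, of F]) (auto simp: mem_const_class_iff)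
    obtain l where l: "a \<longlonglongrightarrow> l"
      using consts_converging_in_measureD(1)[OF conv' g_meas] real_Cauchy_convergent
      by (auto simp: convergent_def)
    have "l \<in> S" using closed_sequentially[OF assms] a(1) l by blast
    then show "G \<in> ?A"
      using meas_funs_eq_const_class[OF G g consts_converging_in_measureD(2)[OF conv' g_meas l]]
      by blast
  qed
  then have "?A = measure_closure M ?A" using measure_closure_superset[OF sub] by blast
  then show ?thesis
    using sub by (auto simp: closedin_def openin_measure_topology topspace_measure_topology)
qed

end

theorem corollary3p2:
  fixes M :: "'a measure"
  assumes "prob_space M"
  shows "\<not> compact_space (measure_topology M)"
proof
  interpret prob_space M by fact
  let ?C = "\<lambda>n. const_class M ` {real n..}"
  assume "compact_space (measure_topology M)"
  then have "(\<Inter>n. ?C n) \<noteq> {}"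
    by (rule compact_space_imp_nest) (auto simp: closedin_const_class_image decseq_def)
  then obtain G where G: "\<And>n. G \<in> ?C n" by auto
  then obtain c where "G = const_class M c" by blast
  \<comment> \<open>By injectivity the same \<open>c\<close> must lie in every half-line, which the
    Archimedean property excludes.\<close>
  with G have "\<And>n. real n \<le> c" by (simp add: inj_image_mem_iff[OF inj_const_class])
  moreover obtain n where "c < real n" using reals_Archimedean2 by blast
  ultimately show False by (simp add: leD)
qed

end
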